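(* Let $a>b>0$, let $\mathcal{E}$ be the ellipse $(x/a)^2+(y/b)^2=1$, and let $k_7=\sqrt{4a^4-5a^2b^2+b^4}$. The iso-$X_7$ family, i.e., the Poncelet family of triangles inscribed in $\mathcal{E}$ whose common incircle has center $\left[\frac{k_7}{2a},0\right]$ and radius $\frac{b^2}{2a}$, conserves the radius $R_A$ of the Adams circle, and its value is given by $$R_A=\frac{b^2}{2a}\sqrt{\frac{5a^2-b^2}{4a^2-b^2}}.$$
   Context: Points of the plane are written $[x,y]$. The Poncelet family of triangles inscribed in $\mathcal{E}$ with a given circle as incircle (caustic) is the set of all triangles with vertices on $\mathcal{E}$ whose three sides are tangent to the circle; for the circle given, every point of $\mathcal{E}$ is a vertex of such a triangle. The Adams circle of a triangle with sidelengths $l_1,l_2,l_3$, inradius $r$ and semiperimeter $s$ is centered on the incenter and has radius $$R_A=\frac{r\sqrt{\rho^2-l_1l_2l_3\,s-\rho s^2}}{\rho-s^2},\qquad \rho=l_1l_2+l_2l_3+l_3l_1.$$ A quantity is conserved if it has the same value for all triangles in the family. *)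

theory Defs
  imports "HOL-Analysis.Analysis"
begin

text \<open>Triangles are triples of points; non-degeneracy is imposed where it is needed, in
  \<open>poncelet_family\<close>.\<close>

type_synonym triangle = "(real^2) \<times> (real^2) \<times> (real^2)"

definition ellipse :: "real \<Rightarrow> real \<Rightarrow> (real^2) set" where
  "ellipse a b = {P. (P$1 / a)\<^sup>2 + (P$2 / b)\<^sup>2 = 1}"

text \<open>The line through \<open>A\<close> and \<open>B\<close> is tangent to the circle, and the point of contact lies on
  the side itself rather than on its prolongation; this separates the incircle from the excircles.\<close>

definition side_tangent :: "real^2 \<Rightarrow> real^2 \<Rightarrow> real^2 \<Rightarrow> real \<Rightarrow> bool" where
  "side_tangent A B M r \<longleftrightarrow>
     (\<exists>T \<in> closed_segment A B. affine hull {A, B} \<inter> sphere M r = {T})"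

definition is_incircle :: "real^2 \<Rightarrow> real \<Rightarrow> triangle \<Rightarrow> bool" where
  "is_incircle M r = (\<lambda>(A, B, C). r > 0 \<and>
     side_tangent A B M r \<and> side_tangent B C M r \<and> side_tangent C A M r)"

definition inradius :: "triangle \<Rightarrow> real" where
  "inradius \<Delta> = (THE r. \<exists>M. is_incircle M r \<Delta>)"

definition poncelet_family :: "(real^2) set \<Rightarrow> real^2 \<Rightarrow> real \<Rightarrow> triangle set" where
  "poncelet_family E M r =
     {(A, B, C). A \<in> E \<and> B \<in> E \<and> C \<in> E \<and> \<not> collinear {A, B, C} \<and>
        is_incircle M r (A, B, C)}"

definition adams_radius :: "triangle \<Rightarrow> real" where
  "adams_radius = (\<lambda>(A, B, C).
     let l1 = dist B C; l2 = dist C A; l3 = dist A B;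
         s = (l1 + l2 + l3) / 2;
         \<rho> = l1 * l2 + l2 * l3 + l3 * l1;
         r = inradius (A, B, C)
     in r * sqrt (\<rho>\<^sup>2 - l1 * l2 * l3 * s - \<rho> * s\<^sup>2) / (\<rho> - s\<^sup>2))"

end

theory Submission
  imports Defs
begin

text \<open>
  Let \<open>x, y, z\<close> be the lengths of the tangents from the vertices \<open>A, B, C\<close> to the incircle,
  \<open>s = x + y + z\<close> and \<open>q = x y + y z + z x\<close>. In terms of these, \<open>\<rho> = s\<^sup>2 + q\<close> and
  \<open>l1 l2 l3 = q s - x y z = (q - r\<^sup>2) s\<close>, so the Adams radius collapses to
  \<open>r sqrt (1 + (r s / q)\<^sup>2)\<close>. Since \<open>q / (r s) = r / x + r / y + r / z\<close> is the sum of the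
  tangents of the half-angles of the triangle, it suffices to show that this sum has square
  \<open>(4 a\<^sup>2 - b\<^sup>2) / a\<^sup>2\<close> throughout the family.

  Take the incenter as the origin of the complex plane and let \<open>r u\<close>, \<open>r v\<close>, \<open>r w\<close> be the contact
  points of \<open>BC\<close>, \<open>CA\<close>, \<open>AB\<close>, so that \<open>u, v, w\<close> are unit complex numbers. If a vertex
  lies on the ellipse, its two contact points satisfy a symmetric relation that is quadratic in
  each of them (\<open>conic_relation_of_ellipse\<close>). Hence for fixed \<open>v\<close> the numbers \<open>u\<close> and \<open>w\<close> are
  the two roots of a quadratic. By Vieta, and because the given circle satisfies Poncelet's closing
  condition, the elementary symmetric functions \<open>e1, e2, e3\<close> of \<open>u, v, w\<close> satisfy
  \<open>e1 = m + n e3\<close> and \<open>e2 = n + m e3\<close> with real constants \<open>m, n\<close> (\<open>porism_linear\<close>). The family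
  therefore depends on the single parameter \<open>e3\<close>.

  On the other hand \<open>r / x = \<i> (v + w) / (v - w)\<close> and its cyclic analogues express the square of the
  half-angle sum as \<open>- (9 e3 - e1 e2)\<^sup>2\<close> divided by the discriminant of \<open>u, v, w\<close>. What is special
  about the circle of the iso-\<open>X\<^sub>7\<close> family is the relation \<open>m\<^sup>2 = n (3 + n)\<close>; under it the
  quotient is independent of \<open>e3\<close> and equals \<open>(3 + n) / (1 - n)\<close> (\<open>discriminant_identity\<close>).
  Geometrically, all contact triangles then share their Brocard angle, whose cotangent is the
  half-angle sum.
\<close>

section \<open>Tangent sides in complex coordinates\<close>

definition coord :: "real^2 \<Rightarrow> real^2 \<Rightarrow> complex" where
  "coord M P = Complex (P$1 - M$1) (P$2 - M$2)"

lemma dist_coord: "dist P Q = cmod (coord M P - coord M Q)"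
  by (simp add: dist_norm norm_vec_def L2_set_def UNIV_2 coord_def cmod_def)

lemma collinear_of_common_tangent:
  assumes w: "cmod w = 1" and "\<And>P. P \<in> S \<Longrightarrow> Re (cnj w * coord M P) = r"
  shows "collinear S"
  unfolding collinear_def
proof (intro exI ballI)
  fix P Q assume "P \<in> S" "Q \<in> S"
  then have eq: "Re (cnj w * (coord M P - coord M Q)) = 0"
    using assms(2)[of P] assms(2)[of Q] by (simp add: algebra_simps)
  define h where "h = Im (cnj w * (coord M P - coord M Q))"
  have ww: "w * cnj w = 1"
    using w complex_norm_square[of w] by simp
  have "cnj w * (coord M P - coord M Q) = \<i> * h"
    using eq by (simp add: complex_eq_iff h_def)
  then have "coord M P - coord M Q = w * (\<i> * h)"
    using ww by (metis mult.assoc mult_1)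
  then have "P$1 - Q$1 = h * (- Im w)" "P$2 - Q$2 = h * Re w"
    by (auto simp: complex_eq_iff coord_def)
  then show "P - Q = h *\<^sub>R vector [- Im w, Re w]"
    by (simp add: vec_eq_iff forall_2 mult.commute)
qed

text \<open>A line that meets a circle in a single point is perpendicular there to the radius, because
  the reflection of the contact point in the foot of the perpendicular from the center is again a
  common point. In complex coordinates the two ends of the side are therefore the contact point
  moved along \<open>\<plusminus> \<i> w\<close>, and contact within the segment means that they lie on opposite sides
  of it; this is the sign condition \<open>x * y \<ge> 0\<close>.\<close>

lemma tangent_side_coord:
  assumes "side_tangent A B M r" "r > 0"
  obtains w x y where "cmod w = 1" "x * y \<ge> 0"
    "coord M A = w * Complex r x" "coord M B = w * Complex r (- y)"
proof -
  obtain T where T: "T \<in> closed_segment A B" "affine hull {A, B} \<inter> sphere M r = {T}"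
    using assms(1) unfolding side_tangent_def by blast
  define D where "D = A - B"
  define N where "N = T - M"
  define T' where "T' = T - (2 * (N \<bullet> D) / (D \<bullet> D)) *\<^sub>R D"
  \<comment> \<open>\<open>T'\<close> is the mirror image of \<open>T\<close> in the foot of the perpendicular from \<open>M\<close> to
    the line.\<close>
  have "T \<in> affine hull {A, B}" "norm N = r"
    using T(2) by (auto simp: N_def dist_norm norm_minus_commute)
  then obtain p q where pq: "T = p *\<^sub>R A + q *\<^sub>R B" "p + q = 1"
    by (auto simp: affine_hull_2)
  have "T' = (p - 2 * (N \<bullet> D) / (D \<bullet> D)) *\<^sub>R A + (q + 2 * (N \<bullet> D) / (D \<bullet> D)) *\<^sub>R B"
    by (simp add: T'_def pq D_def algebra_simps)
  then have "T' \<in> affine hull {A, B}"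
    unfolding affine_hull_2 using pq(2) by force
  moreover have "dist M T' = r"
  proof -
    have "(T' - M) \<bullet> (T' - M) = N \<bullet> N"
    proof (cases "D = 0")
      case False
      define c where "c = 2 * (N \<bullet> D) / (D \<bullet> D)"
      have "c * (D \<bullet> D) = 2 * (N \<bullet> D)" using False by (simp add: c_def)
      moreover have "T' - M = N - c *\<^sub>R D" by (simp add: T'_def N_def c_def)
      moreover have "(N - c *\<^sub>R D) \<bullet> (N - c *\<^sub>R D) = N \<bullet> N - c * (2 * (N \<bullet> D) - c * (D \<bullet> D))"
        by (simp add: inner_diff_left inner_diff_right inner_commute algebra_simps)
      ultimately show ?thesis by simp
    qed (simp add: T'_def N_def)
    then show ?thesis
      using \<open>norm N = r\<close> by (metis dist_commute dist_norm norm_eq)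
  qed
  ultimately have "T' \<in> affine hull {A, B} \<inter> sphere M r" by simp
  then have "T' = T" unfolding T(2) by simp
  then have "(2 * (N \<bullet> D) / (D \<bullet> D)) *\<^sub>R D = 0" unfolding T'_def by (metis diff_eq_eq add_cancel_left_right)
  then have perp: "N \<bullet> D = 0" by (cases "D = 0") simp_all
  obtain t where t: "0 \<le> t" "t \<le> 1" "T = (1 - t) *\<^sub>R A + t *\<^sub>R B"
    using T(1) by (auto simp: closed_segment_def)
  define w where "w = coord M T / r"
  define h where "h = Im (cnj w * (coord M A - coord M B))"
  have "cmod (coord M T) = r"
    using \<open>norm N = r\<close> dist_coord[of T M M] by (simp add: coord_def N_def dist_norm zero_complex.code[symmetric])
  then have w: "cmod w = 1" using assms(2) by (simp add: w_def norm_divide)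
  have ww: "w * cnj w = 1"
    using w complex_norm_square[of w] by simp
  have "Re (cnj w * (coord M A - coord M B)) = (N \<bullet> D) / r"
    using assms(2)
    by (simp add: w_def coord_def N_def D_def inner_vec_def UNIV_2) (simp add: field_simps)
  then have "Re (cnj w * (coord M A - coord M B)) = 0" by (simp add: perp)
  then have "cnj w * (coord M A - coord M B) = \<i> * h"
    by (simp add: complex_eq_iff h_def)
  then have diff: "coord M A - coord M B = w * (\<i> * h)"
    using ww by (metis mult.assoc mult_1)
  have rw: "coord M T = w * r" using assms(2) by (simp add: w_def)
  have "coord M T = (1 - t) * coord M A + t * coord M B"
    by (simp add: t(3) coord_def complex_eq_iff algebra_simps)
  then have "coord M A = coord M T + t * (coord M A - coord M B)"
    "coord M B = coord M T - (1 - t) * (coord M A - coord M B)"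
    by (simp_all add: algebra_simps)
  then have "coord M A = w * Complex r (t * h)" "coord M B = w * Complex r (- ((1 - t) * h))"
    unfolding diff rw by (simp_all add: Complex_eq algebra_simps)
  moreover have "(t * h) * ((1 - t) * h) \<ge> 0"
  proof -
    have "0 \<le> t * (1 - t) * h\<^sup>2" using t by simp
    then show ?thesis by (simp only: power2_eq_square ac_simps)
  qed
  ultimately show ?thesis using that w by blast
qed

text \<open>The two tangents from a point to a circle are equally long. A negative \<open>x' / x\<close> would make
  them the same line, and \<open>x = 0\<close> would put the vertex on the circle, where only one tangent
  exists.\<close>

lemma vertex_tangent_lengths:
  assumes "cmod v = 1" "cmod w = 1" "v \<noteq> w" "r > 0"
    and "w * Complex r x = v * Complex r (- x')"
  shows "x' = x" "x \<noteq> 0"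
proof -
  have Complex_nz: "Complex r h \<noteq> 0" for h
    using assms(4) by (simp add: complex_eq_iff)
  have "cmod (Complex r x) = cmod (Complex r (- x'))"
    using assms(1,2,5) by (metis mult_1 norm_mult)
  then have "x\<^sup>2 = x'\<^sup>2" by (simp add: cmod_def)
  moreover have "- x' \<noteq> x"
  proof
    assume "- x' = x"
    then have "(w - v) * Complex r x = 0" using assms(5) by (simp add: algebra_simps)
    then show False using assms(3) Complex_nz by simp
  qed
  ultimately show "x' = x" "x \<noteq> 0"
    by (auto simp: power2_eq_iff)
qed

text \<open>Here \<open>r * u\<close>, \<open>r * v\<close>, \<open>r * w\<close> are the contact points on \<open>BC\<close>, \<open>CA\<close>, \<open>AB\<close>. The
  tangent lengths \<open>x, y, z\<close> carry a common sign, the orientation of the triangle, so that both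
  orientations are described by the same equations.\<close>

locale incircle_coords =
  fixes A B C M :: "real^2" and r :: real and u v w :: complex and x y z :: real
  assumes r: "r > 0"
    and unit: "cmod u = 1" "cmod v = 1" "cmod w = 1"
    and distinct: "u \<noteq> v" "v \<noteq> w" "w \<noteq> u"
    and same_sign: "x * y > 0" "y * z > 0" "z * x > 0"
    and A: "coord M A = w * Complex r x" "coord M A = v * Complex r (- x)"
    and B: "coord M B = u * Complex r y" "coord M B = w * Complex r (- y)"
    and C: "coord M C = v * Complex r z" "coord M C = u * Complex r (- z)"

text \<open>If two of the contact points coincided, all three vertices would lie on the tangent at that
  point.\<close>

lemma incircle_coords_exist:
  assumes inc: "is_incircle M r (A, B, C)" and ncol: "\<not> collinear {A, B, C}"
  obtains u v w x y z where "incircle_coords A B C M r u v w x y z"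
proof -
  have r: "r > 0" and t: "side_tangent A B M r" "side_tangent B C M r" "side_tangent C A M r"
    using inc by (auto simp: is_incircle_def)
  obtain w x y' where w: "cmod w = 1" "x * y' \<ge> 0"
    "coord M A = w * Complex r x" "coord M B = w * Complex r (- y')"
    using tangent_side_coord[OF t(1) r] by blast
  obtain u y z' where u: "cmod u = 1" "y * z' \<ge> 0"
    "coord M B = u * Complex r y" "coord M C = u * Complex r (- z')"
    using tangent_side_coord[OF t(2) r] by blast
  obtain v z x' where v: "cmod v = 1" "z * x' \<ge> 0"
    "coord M C = v * Complex r z" "coord M A = v * Complex r (- x')"
    using tangent_side_coord[OF t(3) r] by blast
  have Re: "Re (cnj p * (p * Complex r q)) = r" if "cmod p = 1" for p q
  proof -
    have "cnj p * p = 1" using that complex_norm_square[of p] by (simp add: mult.commute)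
    then show ?thesis by (simp add: mult.assoc[symmetric])
  qed
  have no_common: False
    if "cmod p = 1" "\<And>P. P \<in> {A, B, C} \<Longrightarrow> \<exists>q. coord M P = p * Complex r q" for p
  proof -
    have "collinear {A, B, C}"
      using that(2) Re[OF that(1)] by (intro collinear_of_common_tangent[OF that(1), of _ M r]) force
    then show False using ncol by simp
  qed
  have d: "u \<noteq> v" "v \<noteq> w" "w \<noteq> u"
    using no_common[OF u(1)] no_common[OF v(1)] u v w by (blast | metis empty_iff insert_iff)+
  have x: "x' = x" "x \<noteq> 0"
    using vertex_tangent_lengths[OF v(1) w(1) d(2) r, of x x'] v w by auto
  have y: "y' = y" "y \<noteq> 0"
    using vertex_tangent_lengths[OF w(1) u(1) d(3) r, of y y'] u w by auto
  have z: "z' = z" "z \<noteq> 0"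
    using vertex_tangent_lengths[OF u(1) v(1) d(1) r, of z z'] u v by auto
  have "incircle_coords A B C M r u v w x y z"
    using r u v w x y z d by unfold_locales (auto simp: less_le)
  then show ?thesis using that by blast
qed

context incircle_coords
begin

lemma nonzero: "x \<noteq> 0" "y \<noteq> 0" "z \<noteq> 0"
  using same_sign by auto

text \<open>Multiplying the three vertices, once with either of their two representations, shows that
  \<open>(r + \<i> x) (r + \<i> y) (r + \<i> z)\<close> equals its conjugate; the identity says that its imaginary part
  vanishes.\<close>

lemma radius_identity: "r\<^sup>2 * (x + y + z) = x * y * z"
proof -
  have "w * Complex r x * (u * Complex r y) * (v * Complex r z)
      = v * Complex r (- x) * (w * Complex r (- y)) * (u * Complex r (- z))"
    using A B C by metis
  then have "(u * v * w) * (Complex r x * Complex r y * Complex r z)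
      = (u * v * w) * (Complex r (- x) * Complex r (- y) * Complex r (- z))"
    by (simp only: ac_simps)
  moreover have "u * v * w \<noteq> 0" using unit by auto
  ultimately have "Complex r x * Complex r y * Complex r z
      = Complex r (- x) * Complex r (- y) * Complex r (- z)" by simp
  then show ?thesis
    by (simp add: complex_eq_iff algebra_simps power2_eq_square)
qed

lemma side_lengths:
  "dist B C = \<bar>y\<bar> + \<bar>z\<bar>" "dist C A = \<bar>z\<bar> + \<bar>x\<bar>" "dist A B = \<bar>x\<bar> + \<bar>y\<bar>"
proof -
  have side: "cmod (p * Complex r h - p * Complex r (- k)) = \<bar>h\<bar> + \<bar>k\<bar>"
    if "cmod p = 1" "h * k > 0" for p h k
  proof -
    have "p * Complex r h - p * Complex r (- k) = p * (\<i> * of_real (h + k))"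
      by (simp add: Complex_eq algebra_simps)
    then have "cmod (p * Complex r h - p * Complex r (- k)) = \<bar>h + k\<bar>"
      using that(1) by (simp only: norm_mult norm_of_real) simp
    then show ?thesis using that(2) by (auto simp: zero_less_mult_iff)
  qed
  show "dist B C = \<bar>y\<bar> + \<bar>z\<bar>"
    unfolding dist_coord[of _ _ M] B(1) C(2) using side unit same_sign by blast
  show "dist C A = \<bar>z\<bar> + \<bar>x\<bar>"
    unfolding dist_coord[of _ _ M] C(1) A(2) using side unit same_sign by blast
  show "dist A B = \<bar>x\<bar> + \<bar>y\<bar>"
    unfolding dist_coord[of _ _ M] A(1) B(2) using side unit same_sign by blast
qed

text \<open>This formula determines the radius from the sides alone, which makes the definite description
  in \<open>inradius\<close> well-defined.\<close>

lemma heron_radius: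
  fixes s defines "s \<equiv> (dist B C + dist C A + dist A B) / 2"
  shows "r = sqrt ((s - dist B C) * (s - dist C A) * (s - dist A B) / s)"
proof -
  have s: "s - dist B C = \<bar>x\<bar>" "s - dist C A = \<bar>y\<bar>" "s - dist A B = \<bar>z\<bar>" "s = \<bar>x\<bar> + \<bar>y\<bar> + \<bar>z\<bar>"
    by (simp_all add: s_def side_lengths field_simps)
  have "\<bar>x + y + z\<bar> = \<bar>x\<bar> + \<bar>y\<bar> + \<bar>z\<bar>"
    using same_sign by (auto simp: zero_less_mult_iff)
  then have "r\<^sup>2 * s = \<bar>x\<bar> * \<bar>y\<bar> * \<bar>z\<bar>"
    using arg_cong[OF radius_identity, of abs] by (simp add: abs_mult s(4))
  moreover have "s > 0" using nonzero by (simp add: s(4))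
  ultimately have "r\<^sup>2 = (s - dist B C) * (s - dist C A) * (s - dist A B) / s"
    unfolding s(1-3) by (simp add: field_simps)
  then show ?thesis using r by (metis abs_of_pos real_sqrt_abs)
qed

end

lemma inradius_eq:
  assumes "is_incircle M r (A, B, C)" "\<not> collinear {A, B, C}"
  shows "inradius (A, B, C) = r"
  unfolding inradius_def
proof (rule the_equality)
  show "\<exists>M. is_incircle M r (A, B, C)" using assms(1) ..
next
  fix r' assume "\<exists>M. is_incircle M r' (A, B, C)"
  then obtain M' where "is_incircle M' r' (A, B, C)" ..
  then show "r' = r"
    using incircle_coords_exist[OF _ assms(2)] assms(1) incircle_coords.heron_radius by metis
qed

section \<open>The Adams radius in terms of tangent lengths\<close>

lemma adams_algebra:
  fixes x y z r :: real
  assumes "x > 0" "y > 0" "z > 0" "r > 0" and rad: "r\<^sup>2 * (x + y + z) = x * y * z"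
    and l: "l1 = y + z" "l2 = z + x" "l3 = x + y"
    and s: "s = (l1 + l2 + l3) / 2" and \<rho>: "\<rho> = l1 * l2 + l2 * l3 + l3 * l1"
  shows "r * sqrt (\<rho>\<^sup>2 - l1 * l2 * l3 * s - \<rho> * s\<^sup>2) / (\<rho> - s\<^sup>2)
    = r * sqrt (1 + (r * (x + y + z) / (x * y + y * z + z * x))\<^sup>2)"
proof -
  define q where "q = x * y + y * z + z * x"
  have q: "q > 0" using assms(1-3) by (simp add: q_def add_pos_pos)
  have s': "s = x + y + z" by (simp add: s l)
  have \<rho>': "\<rho> = s\<^sup>2 + q" by (simp add: \<rho> l s' q_def power2_eq_square algebra_simps)
  have "l1 * l2 * l3 = q * s - x * y * z"
    by (simp add: l s' q_def algebra_simps)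
  then have prod: "l1 * l2 * l3 = q * s - r\<^sup>2 * s" using rad s' by simp
  have "\<rho>\<^sup>2 - l1 * l2 * l3 * s - \<rho> * s\<^sup>2 = q\<^sup>2 + (r * s)\<^sup>2"
    unfolding prod by (simp add: \<rho>' power2_eq_square algebra_simps)
  also have "\<dots> = q\<^sup>2 * (1 + (r * s / q)\<^sup>2)"
    using q by (simp add: power_divide distrib_left)
  finally have "sqrt (\<rho>\<^sup>2 - l1 * l2 * l3 * s - \<rho> * s\<^sup>2) = q * sqrt (1 + (r * s / q)\<^sup>2)"
    using q by (simp add: real_sqrt_mult)
  moreover have "\<rho> - s\<^sup>2 = q" by (simp add: \<rho>')
  ultimately show ?thesis using q by (simp only: q_def[symmetric] s'[symmetric]) simp
qed

lemma (in incircle_coords) adams_radius_eq: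
  assumes "inradius (A, B, C) = r"
  shows "adams_radius (A, B, C)
    = r * sqrt (1 + (r * (x + y + z) / (x * y + y * z + z * x))\<^sup>2)"
proof -
  have abs: "\<bar>x\<bar> * \<bar>y\<bar> = x * y" "\<bar>y\<bar> * \<bar>z\<bar> = y * z" "\<bar>z\<bar> * \<bar>x\<bar> = z * x"
    using same_sign by (simp_all add: abs_mult[symmetric])
  have abs_sum: "\<bar>x\<bar> + \<bar>y\<bar> + \<bar>z\<bar> = \<bar>x + y + z\<bar>"
    using same_sign by (auto simp: zero_less_mult_iff)
  have rad: "r\<^sup>2 * (\<bar>x\<bar> + \<bar>y\<bar> + \<bar>z\<bar>) = \<bar>x\<bar> * \<bar>y\<bar> * \<bar>z\<bar>"
    using arg_cong[OF radius_identity, of abs] by (simp add: abs_mult abs_sum)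
  have "adams_radius (A, B, C)
    = r * sqrt (1 + (r * (\<bar>x\<bar> + \<bar>y\<bar> + \<bar>z\<bar>) / (\<bar>x\<bar> * \<bar>y\<bar> + \<bar>y\<bar> * \<bar>z\<bar> + \<bar>z\<bar> * \<bar>x\<bar>))\<^sup>2)"
    unfolding adams_radius_def prod.case Let_def assms
    by (rule adams_algebra[OF _ _ _ r rad side_lengths refl refl]) (use nonzero in auto)
  then show ?thesis
    unfolding abs abs_sum by (simp add: power_divide power_mult_distrib)
qed

section \<open>Contact points of tangents from points of an ellipse\<close>

text \<open>For the coefficients in \<open>conic_relation_of_ellipse\<close> this is the equation
  \<open>(d \<sigma> + r (\<pi> + 1))\<^sup>2 / a\<^sup>2 - r\<^sup>2 (\<pi> - 1)\<^sup>2 / b\<^sup>2 = \<sigma>\<^sup>2\<close> with \<open>\<sigma> = p + q\<close> and \<open>\<pi> = p q\<close>,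
  expanded so that its symmetry and its coefficients as a quadratic in \<open>q\<close> can be read off. It is
  the \<open>(2,2)\<close>-correspondence underlying Poncelet's theorem.\<close>

definition conic_relation :: "real \<Rightarrow> real \<Rightarrow> real \<Rightarrow> real \<Rightarrow> complex \<Rightarrow> complex \<Rightarrow> bool" where
  "conic_relation \<alpha> \<beta> \<gamma> \<delta> p q \<longleftrightarrow>
     \<alpha> * (p\<^sup>2 + q\<^sup>2) + 2 * \<beta> * (p + q) * (p * q + 1) + \<gamma> * (p\<^sup>2 * q\<^sup>2 + 1) + 2 * (\<alpha> + \<delta>) * p * q = 0"

text \<open>The intersection \<open>Z\<close> of the tangents at \<open>r * p\<close> and \<open>r * q\<close> satisfies
  \<open>Z (p + q) = 2 r p q\<close> and \<open>cnj Z (p + q) = 2 r\<close>. So the real coordinates of \<open>Z\<close>, multiplied by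
  \<open>p + q\<close>, are polynomials in \<open>p\<close> and \<open>q\<close>, and the claim is the equation of the ellipse
  multiplied by \<open>(p + q)\<^sup>2\<close>.\<close>

lemma conic_relation_of_ellipse:
  fixes p q :: complex and d r a b x :: real
  assumes unit: "cmod p = 1" "cmod q = 1"
    and P: "coord M P = p * Complex r x" "coord M P = q * Complex r (- x)"
    and M: "M = vector [d, 0]" and ell: "P \<in> ellipse a b"
  shows "conic_relation (d\<^sup>2 / a\<^sup>2 - 1) (d * r / a\<^sup>2) (r\<^sup>2 / a\<^sup>2 - r\<^sup>2 / b\<^sup>2) (r\<^sup>2 / a\<^sup>2 + r\<^sup>2 / b\<^sup>2) p q"
proof -
  define Z where "Z = coord M P"
  have pp: "p * cnj p = 1" "q * cnj q = 1"
    using unit complex_norm_square[of p] complex_norm_square[of q] by simp_all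
  have cnj_Complex: "cnj (Complex r x) = Complex r (- x)" "cnj (Complex r (- x)) = Complex r x"
    by (simp_all add: complex_eq_iff)
  have "cnj Z * p = (p * cnj p) * Complex r (- x)"
    unfolding Z_def P(1) complex_cnj_mult cnj_Complex by (simp only: ac_simps)
  then have cZp: "cnj Z * p = Complex r (- x)" using pp by simp
  have "cnj Z * q = (q * cnj q) * Complex r x"
    unfolding Z_def P(2) complex_cnj_mult cnj_Complex by (simp only: ac_simps)
  then have cZq: "cnj Z * q = Complex r x" using pp by simp
  have rr: "Complex r x + Complex r (- x) = 2 * r" by (simp add: complex_eq_iff)
  have "Z * (p + q) = p * q * (Complex r x + Complex r (- x))"
  proof -
    have "Z * q = p * q * Complex r x"
      unfolding Z_def P(1) by (simp only: ac_simps)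
    moreover have "Z * p = p * q * Complex r (- x)"
      unfolding Z_def P(2) by (simp only: ac_simps)
    ultimately show ?thesis by (simp only: distrib_left add.commute)
  qed
  then have Zs: "Z * (p + q) = 2 * r * (p * q)"
    unfolding rr by (simp only: ac_simps)
  have cZs: "cnj Z * (p + q) = 2 * r"
    unfolding distrib_left cZp cZq rr[symmetric] by (rule add.commute)
  define X Y where "X = Re Z" and "Y = Im Z"
  have XY: "of_real X = (Z + cnj Z) / 2" "\<i> * of_real Y = (Z - cnj Z) / 2"
    by (simp_all add: X_def Y_def complex_eq_iff)
  have X: "of_real X * (p + q) = r * (p * q + 1)"
  proof -
    have "of_real X * (p + q) = (Z * (p + q) + cnj Z * (p + q)) / 2"
      unfolding XY by (simp add: distrib_right)
    also have "\<dots> = r * (p * q + 1)" unfolding Zs cZs by (simp add: distrib_left)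
    finally show ?thesis .
  qed
  have Y: "\<i> * of_real Y * (p + q) = r * (p * q - 1)"
  proof -
    have "\<i> * of_real Y * (p + q) = (Z * (p + q) - cnj Z * (p + q)) / 2"
      unfolding XY by (simp add: left_diff_distrib)
    also have "\<dots> = r * (p * q - 1)" unfolding Zs cZs by (simp add: right_diff_distrib)
    finally show ?thesis .
  qed
  define f g where "f = 1 / a\<^sup>2" and "g = 1 / b\<^sup>2"
  have "(d + X)\<^sup>2 * f + Y\<^sup>2 * g = 1"
    using ell by (simp add: M ellipse_def X_def Y_def Z_def coord_def power_divide f_def g_def)
  then have E: "(complex_of_real d + of_real X)\<^sup>2 * of_real f + (of_real Y)\<^sup>2 * of_real g = 1"
    by (metis of_real_1 of_real_add of_real_mult of_real_power)
  have "(d * (p + q) + of_real X * (p + q))\<^sup>2 * f - (\<i> * of_real Y * (p + q))\<^sup>2 * g - (p + q)\<^sup>2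
     = ((complex_of_real d + of_real X)\<^sup>2 * of_real f + (of_real Y)\<^sup>2 * of_real g - 1) * (p + q)\<^sup>2"
    by (simp add: power_mult_distrib distrib_right[symmetric] left_diff_distrib)
       (simp add: algebra_simps power_mult_distrib)
  also have "\<dots> = 0" unfolding E by simp
  finally have "(d * (p + q) + r * (p * q + 1))\<^sup>2 * f - (r * (p * q - 1))\<^sup>2 * g - (p + q)\<^sup>2 = 0"
    unfolding X Y .
  then have "conic_relation (d\<^sup>2 * f - 1) (d * r * f) (r\<^sup>2 * f - r\<^sup>2 * g) (r\<^sup>2 * f + r\<^sup>2 * g) p q"
    unfolding conic_relation_def by (simp add: algebra_simps power2_eq_square)
  then show ?thesis by (simp add: f_def g_def)
qed

lemma conic_vieta:
  assumes "conic_relation \<alpha> \<beta> \<gamma> \<delta> v w" "conic_relation \<alpha> \<beta> \<gamma> \<delta> v u" "u \<noteq> w"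
  defines "Q \<equiv> \<alpha> + 2 * \<beta> * v + \<gamma> * v\<^sup>2"
  shows "Q * (u + w) = - 2 * (\<beta> * (1 + v\<^sup>2) + (\<alpha> + \<delta>) * v)"
    and "Q * (u * w) = \<alpha> * v\<^sup>2 + 2 * \<beta> * v + \<gamma>"
proof -
  define L where "L = 2 * (\<beta> * (1 + v\<^sup>2) + (\<alpha> + \<delta>) * v)"
  define K where "K = \<alpha> * v\<^sup>2 + 2 * \<beta> * v + \<gamma>"
  have w: "Q * w\<^sup>2 + L * w + K = 0"
    using assms(1) by (simp add: conic_relation_def Q_def L_def K_def algebra_simps power2_eq_square)
  have u: "Q * u\<^sup>2 + L * u + K = 0"
    using assms(2) by (simp add: conic_relation_def Q_def L_def K_def algebra_simps power2_eq_square)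
  have "(u - w) * (Q * (u + w) + L) = (Q * u\<^sup>2 + L * u + K) - (Q * w\<^sup>2 + L * w + K)"
    by (simp add: algebra_simps power2_eq_square)
  then have sum: "Q * (u + w) + L = 0" using u w assms(3) by simp
  then have "Q * (u + w) = - L" by (simp add: eq_neg_iff_add_eq_0)
  then show "Q * (u + w) = - 2 * (\<beta> * (1 + v\<^sup>2) + (\<alpha> + \<delta>) * v)"
    unfolding L_def by simp
  have "Q * (u * w) - K = w * (Q * (u + w) + L) - (Q * w\<^sup>2 + L * w + K)"
    by (simp add: algebra_simps power2_eq_square)
  then have "Q * (u * w) = K" unfolding sum w by simp
  then show "Q * (u * w) = \<alpha> * v\<^sup>2 + 2 * \<beta> * v + \<gamma>" unfolding K_def .
qed

text \<open>The hypothesis \<open>closing\<close> is the condition under which the correspondence closes up after three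
  steps for every starting point. With \<open>Q v\<close> the leading coefficient of the quadratic with roots
  \<open>u\<close> and \<open>w\<close>, Vieta's formulas turn \<open>Q v\<close> times either linear combination into a polynomial in
  \<open>v\<close> alone, which is a multiple of the closing condition. It remains to cancel \<open>Q\<close>: a
  nonzero polynomial of degree at most two cannot vanish at all three of \<open>u\<close>, \<open>v\<close>, \<open>w\<close>.\<close>

lemma porism_linear:
  fixes u v w :: complex
  assumes rel: "conic_relation \<alpha> \<beta> \<gamma> \<delta> u v"
      "conic_relation \<alpha> \<beta> \<gamma> \<delta> v w"
      "conic_relation \<alpha> \<beta> \<gamma> \<delta> w u"
    and distinct: "u \<noteq> v" "v \<noteq> w" "w \<noteq> u"
    and closing: "\<alpha>\<^sup>2 + 2 * \<alpha> * \<delta> + \<gamma>\<^sup>2 = 4 * \<beta>\<^sup>2" and "\<alpha> \<noteq> 0"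
  shows "\<alpha> * (u + v + w) = \<gamma> * (u * v * w) - 2 * of_real \<beta>"
    and "\<alpha> * (u * v + v * w + w * u) = \<gamma> - 2 * of_real \<beta> * (u * v * w)"
proof -
  have commute: "conic_relation \<alpha> \<beta> \<gamma> \<delta> q p" if "conic_relation \<alpha> \<beta> \<gamma> \<delta> p q" for p q
    using that by (simp add: conic_relation_def ac_simps)
  define Q where "Q t = \<alpha> + 2 * \<beta> * t + \<gamma> * t\<^sup>2" for t :: complex
  have closing': "of_real \<alpha> ^ 2 + 2 * of_real \<alpha> * of_real \<delta> + of_real \<gamma> ^ 2 = 4 * (of_real \<beta> ^ 2 :: complex)"
    using arg_cong[OF closing, of complex_of_real] by simp
  have lin: "Q p * (\<alpha> * (p + q + t) - \<gamma> * (p * q * t) + 2 * of_real \<beta>) = 0"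
      "Q p * (\<alpha> * (p * (q + t) + q * t) - \<gamma> + 2 * of_real \<beta> * (p * q * t)) = 0"
    if "conic_relation \<alpha> \<beta> \<gamma> \<delta> p q" "conic_relation \<alpha> \<beta> \<gamma> \<delta> p t" "q \<noteq> t" for p q t :: complex
  proof -
    note V = conic_vieta[OF that(2,1,3), folded Q_def]
    have "Q p * (\<alpha> * (p + q + t) - \<gamma> * (p * q * t) + 2 * of_real \<beta>)
        = \<alpha> * p * Q p + \<alpha> * (Q p * (q + t)) - \<gamma> * p * (Q p * (q * t)) + 2 * \<beta> * Q p"
      by (simp add: algebra_simps)
    also have "\<dots> = - p * (of_real \<alpha> ^ 2 + 2 * of_real \<alpha> * of_real \<delta> + of_real \<gamma> ^ 2 - 4 * of_real \<beta> ^ 2)"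
      unfolding V unfolding Q_def by (simp add: algebra_simps power2_eq_square)
    finally show "Q p * (\<alpha> * (p + q + t) - \<gamma> * (p * q * t) + 2 * of_real \<beta>) = 0"
      using closing' by simp
    have "Q p * (\<alpha> * (p * (q + t) + q * t) - \<gamma> + 2 * of_real \<beta> * (p * q * t))
        = \<alpha> * p * (Q p * (q + t)) + \<alpha> * (Q p * (q * t)) - \<gamma> * Q p + 2 * \<beta> * p * (Q p * (q * t))"
      by (simp add: algebra_simps)
    also have "\<dots> = - p\<^sup>2 * (of_real \<alpha> ^ 2 + 2 * of_real \<alpha> * of_real \<delta> + of_real \<gamma> ^ 2 - 4 * of_real \<beta> ^ 2)"
      unfolding V unfolding Q_def by (simp add: algebra_simps power2_eq_square)
    finally show "Q p * (\<alpha> * (p * (q + t) + q * t) - \<gamma> + 2 * of_real \<beta> * (p * q * t)) = 0"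
      using closing' by simp
  qed
  have nz: "Q u \<noteq> 0 \<or> Q v \<noteq> 0 \<or> Q w \<noteq> 0"
  proof (rule ccontr)
    assume "\<not> ?thesis"
    then have 0: "Q u = 0" "Q v = 0" "Q w = 0" by auto
    have diff: "Q p - Q q = (p - q) * (2 * \<beta> + \<gamma> * (p + q))" for p q :: complex
      by (simp add: Q_def algebra_simps power2_eq_square)
    have "2 * \<beta> + \<gamma> * (u + v) = 0" "2 * \<beta> + \<gamma> * (v + w) = 0"
      using diff[of u v] diff[of v w] 0 distinct by auto
    moreover have "\<gamma> * (u - w) = (2 * \<beta> + \<gamma> * (u + v)) - (2 * \<beta> + \<gamma> * (v + w))"
      by (simp add: algebra_simps)
    ultimately show False using 0 distinct \<open>\<alpha> \<noteq> 0\<close> by (auto simp: Q_def)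
  qed
  let ?lin = "\<alpha> * (u + v + w) - \<gamma> * (u * v * w) + 2 * of_real \<beta> = 0 \<and>
    \<alpha> * (u * v + v * w + w * u) - \<gamma> + 2 * of_real \<beta> * (u * v * w) = 0"
  have dichotomy: "Q p = 0 \<or> ?lin"
    if "conic_relation \<alpha> \<beta> \<gamma> \<delta> p q" "conic_relation \<alpha> \<beta> \<gamma> \<delta> t p" "q \<noteq> t"
      and "p + q + t = u + v + w" "p * (q + t) + q * t = u * v + v * w + w * u"
        "p * q * t = u * v * w" for p q t
    using lin[OF that(1) commute[OF that(2)] that(3)] unfolding that(4-6)
    by (simp only: mult_eq_0_iff) blast
  have "Q u = 0 \<or> ?lin"
    by (rule dichotomy[OF rel(1,3) distinct(2)]; simp add: algebra_simps)
  moreover have "Q v = 0 \<or> ?lin"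
    by (rule dichotomy[OF rel(2,1) distinct(3)]; simp add: algebra_simps)
  moreover have "Q w = 0 \<or> ?lin"
    by (rule dichotomy[OF rel(3,2) distinct(1)]; simp add: algebra_simps)
  ultimately have ?lin using nz by blast
  then show "\<alpha> * (u + v + w) = \<gamma> * (u * v * w) - 2 * of_real \<beta>"
    "\<alpha> * (u * v + v * w + w * u) = \<gamma> - 2 * of_real \<beta> * (u * v * w)"
    by (simp_all add: algebra_simps)
qed

section \<open>The sum of the tangents of the half-angles\<close>

text \<open>For a cubic with roots \<open>u, v, w\<close>, elementary symmetric functions \<open>e1, e2\<close> and product
  \<open>t\<close>, the long bracket is its discriminant. So the ratio of \<open>(9 t - e1 e2)\<^sup>2\<close> to the
  discriminant does not depend on \<open>t\<close>.\<close>

lemma discriminant_identity: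
  fixes m n t :: complex
  assumes "m\<^sup>2 = n * (3 + n)"
  defines "e1 \<equiv> m + n * t" and "e2 \<equiv> n + m * t"
  shows "(9 * t - e1 * e2)\<^sup>2 * (1 - n)
    = - (3 + n) * (e1\<^sup>2 * e2\<^sup>2 - 4 * e2^3 - 4 * e1^3 * t + 18 * e1 * e2 * t - 27 * t\<^sup>2)"
proof -
  \<comment> \<open>The last factor is the quotient on dividing by \<open>m\<^sup>2 - n * (3 + n)\<close> as a polynomial in \<open>m\<close>.\<close>
  have "(9 * t - e1 * e2)\<^sup>2 * (1 - n)
      + (3 + n) * (e1\<^sup>2 * e2\<^sup>2 - 4 * e2^3 - 4 * e1^3 * t + 18 * e1 * e2 * t - 27 * t\<^sup>2)
    = 4 * (m\<^sup>2 - n * (3 + n)) * (m\<^sup>2 * t\<^sup>2 + m * n * t * (1 + t\<^sup>2) - 3 * m * t * (1 + t\<^sup>2)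
        + 9 * t\<^sup>2 - 6 * n * t\<^sup>2 + n\<^sup>2 - n\<^sup>2 * t\<^sup>2 + n\<^sup>2 * t^4)"
    unfolding e1_def e2_def by algebra
  then have "(9 * t - e1 * e2)\<^sup>2 * (1 - n)
      + (3 + n) * (e1\<^sup>2 * e2\<^sup>2 - 4 * e2^3 - 4 * e1^3 * t + 18 * e1 * e2 * t - 27 * t\<^sup>2) = 0"
    using assms(1) by simp
  then show ?thesis by (simp only: eq_neg_iff_add_eq_0 mult_minus_left)
qed

text \<open>The tangent of the half-angle at \<open>A\<close> is \<open>r / x\<close>, up to the sign of the orientation, and
  equating the two representations of \<open>A\<close> gives \<open>(r / x) (v - w) = \<i> (v + w)\<close>. Summing over the
  vertices, with common denominator \<open>V\<close>, the numerator is symmetric in \<open>u, v, w\<close>, while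
  \<open>V\<^sup>2\<close> is the discriminant.\<close>

lemma (in incircle_coords) half_angle_tangent_sum:
  fixes m n :: real
  assumes e1: "u + v + w = m + n * (u * v * w)"
    and e2: "u * v + v * w + w * u = n + m * (u * v * w)"
    and mn: "m\<^sup>2 = n * (3 + n)"
  shows "(r / x + r / y + r / z)\<^sup>2 * (1 - n) = 3 + n"
proof -
  have half_angle: "of_real (r / h) * (p - q) = \<i> * (p + q)"
    if "q * Complex r h = p * Complex r (- h)" "h \<noteq> 0" for p q h
  proof -
    have "h * (of_real (r / h) * (p - q)) = r * (p - q)" using that(2) by simp
    also have "\<dots> = h * (\<i> * (p + q))"
      using that(1) by (simp add: Complex_eq algebra_simps)
    finally show ?thesis using that(2) by simp
  qed
  have x: "of_real (r / x) * (v - w) = \<i> * (v + w)"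
    using half_angle[of w x v] A nonzero by simp
  have y: "of_real (r / y) * (w - u) = \<i> * (w + u)"
    using half_angle[of u y w] B nonzero by simp
  have z: "of_real (r / z) * (u - v) = \<i> * (u + v)"
    using half_angle[of v z u] C nonzero by simp
  define S where "S = r / x + r / y + r / z"
  define V where "V = (u - v) * (v - w) * (w - u)"
  have "of_real S * V = of_real (r / x) * (v - w) * ((u - v) * (w - u))
      + of_real (r / y) * (w - u) * ((u - v) * (v - w))
      + of_real (r / z) * (u - v) * ((v - w) * (w - u))"
    unfolding S_def V_def of_real_add by algebra
  also have "\<dots> = \<i> * (9 * (u * v * w) - (u + v + w) * (u * v + v * w + w * u))"
    unfolding x y z by algebra
  finally have SV: "of_real S * V
    = \<i> * (9 * (u * v * w) - (u + v + w) * (u * v + v * w + w * u))" .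
  have V2: "V\<^sup>2 = (u + v + w)\<^sup>2 * (u * v + v * w + w * u)\<^sup>2 - 4 * (u * v + v * w + w * u)^3
      - 4 * (u + v + w)^3 * (u * v * w) + 18 * (u + v + w) * (u * v + v * w + w * u) * (u * v * w)
      - 27 * (u * v * w)\<^sup>2"
    unfolding V_def by algebra
  have mn': "(of_real m)\<^sup>2 = of_real n * (3 + of_real n :: complex)"
    using arg_cong[OF mn, of complex_of_real] by simp
  have "(of_real S)\<^sup>2 * (1 - of_real n) * V\<^sup>2 = (of_real S * V)\<^sup>2 * (1 - of_real n)"
    by (simp add: power_mult_distrib)
  also have "\<dots> = - ((9 * (u * v * w) - (u + v + w) * (u * v + v * w + w * u))\<^sup>2 * (1 - of_real n))"
    unfolding SV by (simp add: power_mult_distrib)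
  also have "\<dots> = (3 + of_real n) * V\<^sup>2"
    unfolding V2 unfolding e1 e2 discriminant_identity[OF mn']
    by (simp only: mult_minus_left minus_minus)
  finally have "(of_real S)\<^sup>2 * (1 - of_real n) = (3 + of_real n :: complex)"
    using distinct by (simp add: V_def)
  then have "complex_of_real (S\<^sup>2 * (1 - n)) = of_real (3 + n)" by simp
  then show ?thesis unfolding S_def of_real_eq_iff .
qed

lemma (in incircle_coords) half_angle_tangent_sum_eq:
  "r / x + r / y + r / z = (x * y + y * z + z * x) / (r * (x + y + z))"
proof -
  have "r / x + r / y + r / z = r * (x * y + y * z + z * x) / (x * y * z)"
    using nonzero by (simp add: field_simps)
  also have "\<dots> = (x * y + y * z + z * x) / (r * (x + y + z))"
    using r by (simp add: radius_identity[symmetric] power2_eq_square)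
  finally show ?thesis .
qed

section \<open>The iso-\<open>X\<^sub>7\<close> family\<close>

theorem proposition11:
  fixes a b k7 :: real and \<F> :: "triangle set"
  assumes "a > b" and "b > 0"
    and "k7 = sqrt (4 * a^4 - 5 * a\<^sup>2 * b\<^sup>2 + b^4)"
    and "\<F> = poncelet_family (ellipse a b) (vector [k7 / (2 * a), 0]) (b\<^sup>2 / (2 * a))"
  shows "adams_radius constant_on \<F> \<and>
    (\<forall>\<Delta> \<in> \<F>. adams_radius \<Delta> =
       b\<^sup>2 / (2 * a) * sqrt ((5 * a\<^sup>2 - b\<^sup>2) / (4 * a\<^sup>2 - b\<^sup>2)))"
proof -
  define d r M where "d = k7 / (2 * a)" and "r = b\<^sup>2 / (2 * a)" and "M = (vector [d, 0] :: real^2)"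
  have a: "a > 0" "a \<noteq> 0" "b \<noteq> 0" using assms(1,2) by auto
  have ab: "b\<^sup>2 < a\<^sup>2" using assms(1,2) by (simp add: power_strict_mono)
  have D: "5 * a\<^sup>2 - b\<^sup>2 > 0" "4 * a\<^sup>2 - b\<^sup>2 > 0" using ab zero_less_power[OF a(1), of 2] by linarith+
  have "4 * a^4 - 5 * a\<^sup>2 * b\<^sup>2 + b^4 = (4 * a\<^sup>2 - b\<^sup>2) * (a\<^sup>2 - b\<^sup>2)" by algebra
  then have k7: "k7\<^sup>2 = (4 * a\<^sup>2 - b\<^sup>2) * (a\<^sup>2 - b\<^sup>2)"
    using assms(3) D ab by simp
  define \<alpha> \<beta> \<gamma> \<delta> where "\<alpha> = d\<^sup>2 / a\<^sup>2 - 1" and "\<beta> = d * r / a\<^sup>2"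
    and "\<gamma> = r\<^sup>2 / a\<^sup>2 - r\<^sup>2 / b\<^sup>2" and "\<delta> = r\<^sup>2 / a\<^sup>2 + r\<^sup>2 / b\<^sup>2"
  \<comment> \<open>\<open>K\<close> is the common factor of the four coefficients; without it they are polynomials in
    \<open>a\<^sup>2\<close>, \<open>b\<^sup>2\<close> and \<open>k7\<close>.\<close>
  define K where "K = b\<^sup>2 / (4 * a^4)"
  have K: "K \<noteq> 0" using a by (simp add: K_def)
  have "d\<^sup>2 / a\<^sup>2 = (4 * a\<^sup>2 - b\<^sup>2) * (a\<^sup>2 - b\<^sup>2) / (4 * a^4)"
    unfolding d_def power_divide k7 by (simp add: power2_eq_square power4_eq_xxxx)
  then have \<alpha>: "\<alpha> = - K * (5 * a\<^sup>2 - b\<^sup>2)"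
    unfolding \<alpha>_def K_def using a by (simp add: field_simps)
  have \<beta>: "\<beta> = K * k7"
    using a by (simp add: \<beta>_def d_def r_def K_def field_simps power2_eq_square power4_eq_xxxx)
  have \<gamma>: "\<gamma> = - K * (a\<^sup>2 - b\<^sup>2)"
    using a by (simp add: \<gamma>_def r_def K_def field_simps power2_eq_square power4_eq_xxxx)
  have \<delta>: "\<delta> = K * (a\<^sup>2 + b\<^sup>2)"
    using a by (simp add: \<delta>_def r_def K_def field_simps power2_eq_square power4_eq_xxxx)
  have closing: "\<alpha>\<^sup>2 + 2 * \<alpha> * \<delta> + \<gamma>\<^sup>2 = 4 * \<beta>\<^sup>2"
    unfolding \<alpha> \<beta> \<gamma> \<delta> power_mult_distrib k7 by algebra
  have \<alpha>0: "\<alpha> \<noteq> 0" using K D by (simp add: \<alpha>)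
  \<comment> \<open>These are \<open>- 2 * \<beta> / \<alpha>\<close> and \<open>\<gamma> / \<alpha>\<close>, the coefficients of the linear relations
    between \<open>e1\<close>, \<open>e2\<close> and \<open>e3\<close>.\<close>
  define m n where "m = 2 * k7 / (5 * a\<^sup>2 - b\<^sup>2)" and "n = (a\<^sup>2 - b\<^sup>2) / (5 * a\<^sup>2 - b\<^sup>2)"
  have n: "1 - n = 4 * a\<^sup>2 / (5 * a\<^sup>2 - b\<^sup>2)" "3 + n = 4 * (4 * a\<^sup>2 - b\<^sup>2) / (5 * a\<^sup>2 - b\<^sup>2)"
    using D by (simp_all add: n_def field_simps)
  have mn: "m\<^sup>2 = n * (3 + n)"
    unfolding n unfolding m_def n_def power_divide power_mult_distrib k7 using D
    by (simp add: power2_eq_square)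
  have \<alpha>m: "\<alpha> * m = - 2 * \<beta>" and \<alpha>n: "\<alpha> * n = \<gamma>"
    using D by (simp_all add: \<alpha> \<beta> \<gamma> m_def n_def)
  have adams: "adams_radius \<Delta> = r * sqrt ((5 * a\<^sup>2 - b\<^sup>2) / (4 * a\<^sup>2 - b\<^sup>2))" if "\<Delta> \<in> \<F>" for \<Delta>
  proof -
    obtain A B C where \<Delta>: "\<Delta> = (A, B, C)" by (cases \<Delta>)
    have ell: "A \<in> ellipse a b" "B \<in> ellipse a b" "C \<in> ellipse a b"
      and ncol: "\<not> collinear {A, B, C}" and inc: "is_incircle M r (A, B, C)"
      using that by (auto simp: \<Delta> assms(4) poncelet_family_def M_def d_def r_def)
    obtain u v w x y z where "incircle_coords A B C M r u v w x y z"
      using incircle_coords_exist[OF inc ncol] by blast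
    then interpret incircle_coords A B C M r u v w x y z .
    note rel = conic_relation_of_ellipse[OF _ _ _ _ M_def, of _ _ _ r _ a b,
        folded \<alpha>_def \<beta>_def \<gamma>_def \<delta>_def]
    have "conic_relation \<alpha> \<beta> \<gamma> \<delta> u w" "conic_relation \<alpha> \<beta> \<gamma> \<delta> v u" "conic_relation \<alpha> \<beta> \<gamma> \<delta> w v"
      using rel[OF unit(1,3) B ell(2)] rel[OF unit(2,1) C ell(3)] rel[OF unit(3,2) A ell(1)]
      by auto
    then have lin: "\<alpha> * (u + w + v) = \<gamma> * (u * w * v) - 2 * of_real \<beta>"
      "\<alpha> * (u * w + w * v + v * u) = \<gamma> - 2 * of_real \<beta> * (u * w * v)"
      using porism_linear[of \<alpha> \<beta> \<gamma> \<delta> u w v] distinct closing \<alpha>0 by auto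
    have c: "complex_of_real \<alpha> * m = - 2 * of_real \<beta>" "complex_of_real \<alpha> * n = \<gamma>" "complex_of_real \<alpha> \<noteq> 0"
      using arg_cong[OF \<alpha>m, of complex_of_real] arg_cong[OF \<alpha>n, of complex_of_real] \<alpha>0
      by simp_all
    have "\<alpha> * (u + v + w) = \<alpha> * (m + n * (u * v * w))"
      using lin(1) c(1,2) by algebra
    moreover have "\<alpha> * (u * v + v * w + w * u) = \<alpha> * (n + m * (u * v * w))"
      using lin(2) c(1,2) by algebra
    ultimately have "(r / x + r / y + r / z)\<^sup>2 * (1 - n) = 3 + n"
      using half_angle_tangent_sum[OF _ _ mn] c(3) by simp
    then have "(r / x + r / y + r / z)\<^sup>2 = (4 * a\<^sup>2 - b\<^sup>2) / a\<^sup>2"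
      unfolding n using D a by (simp add: field_simps)
    then have "((x * y + y * z + z * x) / (r * (x + y + z)))\<^sup>2 = (4 * a\<^sup>2 - b\<^sup>2) / a\<^sup>2"
      unfolding half_angle_tangent_sum_eq .
    then have "(r * (x + y + z) / (x * y + y * z + z * x))\<^sup>2 = a\<^sup>2 / (4 * a\<^sup>2 - b\<^sup>2)"
      by (metis inverse_divide power_inverse)
    then have "1 + (r * (x + y + z) / (x * y + y * z + z * x))\<^sup>2 = (5 * a\<^sup>2 - b\<^sup>2) / (4 * a\<^sup>2 - b\<^sup>2)"
      using D by (simp add: field_simps)
    then show ?thesis
      unfolding \<Delta> adams_radius_eq[OF inradius_eq[OF inc ncol]] by simp
  qed
  then show ?thesis
    unfolding constant_on_def r_def by blast
qed

end
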